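(* Given a monoid with an arbitrary topology $(M,\tau)$, there is a canonical (right) powder monoid $(\tilde M,\tilde\tau)$ such that $\mathrm{Cont}(M,\tau)\simeq\mathrm{Cont}(\tilde M,\tilde\tau)$ and the canonical points of these toposes coincide (i.e. the equivalence commutes, up to isomorphism, with the canonical points).
   Context: $\tau$ is any topology on the underlying set of the monoid $M$. An $(M,\tau)$-set is a right $M$-set $X$ whose action $X\times M\to X$ is continuous when $X$ is given the discrete topology; $\mathrm{Cont}(M,\tau)$ is the category of $(M,\tau)$-sets and equivariant maps, which is a Grothendieck topos. Its canonical point is the geometric morphism $\mathbf{Set}\to\mathrm{Cont}(M,\tau)$ whose inverse image functor sends an $(M,\tau)$-set to its underlying set. For $A\subseteq M$, $p\in M$: $p^*(A)=\{m\mid pm\in A\}$, $\mathcal{I}_A^p=\{m\mid m^*(A)=p^*(A)\}$. The action topology induced by a topology $\sigma$ on a monoid has base $\{A\mid\forall p,q,\ \mathcal{I}^p_{q^*(A)}\in\sigma\}$; $\sigma$ is an action topology if it equals the action topology it induces. A (right) powder monoid is a topological monoid (i.e. with continuous multiplication) which is $T_0$ and whose topology is an action topology. *)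

theory Defs
  imports "HOL-Analysis.Analysis" "HOL-Algebra.Coset"
begin

section \<open>Categories, functors, equivalences\<close>

record ('o, 'a) category =
  Obj :: "'o set"
  Arr :: "'a set"
  Dom :: "'a \<Rightarrow> 'o"
  Cod :: "'a \<Rightarrow> 'o"
  Id :: "'o \<Rightarrow> 'a"
  Comp :: "'a \<Rightarrow> 'a \<Rightarrow> 'a"  \<comment> \<open>\<open>Comp C g f\<close> is ``\<open>g\<close> after \<open>f\<close>''\<close>

locale category =
  fixes C :: "('o, 'a) category"
  assumes Dom_closed: "f \<in> Arr C \<Longrightarrow> Dom C f \<in> Obj C"
    and Cod_closed: "f \<in> Arr C \<Longrightarrow> Cod C f \<in> Obj C"
    and Id_closed: "X \<in> Obj C \<Longrightarrow> Id C X \<in> Arr C"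
    and Dom_Id: "X \<in> Obj C \<Longrightarrow> Dom C (Id C X) = X"
    and Cod_Id: "X \<in> Obj C \<Longrightarrow> Cod C (Id C X) = X"
    and Comp_closed: "\<lbrakk>f \<in> Arr C; g \<in> Arr C; Cod C f = Dom C g\<rbrakk> \<Longrightarrow> Comp C g f \<in> Arr C"
    and Dom_Comp: "\<lbrakk>f \<in> Arr C; g \<in> Arr C; Cod C f = Dom C g\<rbrakk> \<Longrightarrow> Dom C (Comp C g f) = Dom C f"
    and Cod_Comp: "\<lbrakk>f \<in> Arr C; g \<in> Arr C; Cod C f = Dom C g\<rbrakk> \<Longrightarrow> Cod C (Comp C g f) = Cod C g"
    and Comp_Id_right: "f \<in> Arr C \<Longrightarrow> Comp C f (Id C (Dom C f)) = f"
    and Comp_Id_left: "f \<in> Arr C \<Longrightarrow> Comp C (Id C (Cod C f)) f = f"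
    and Comp_assoc: "\<lbrakk>f \<in> Arr C; g \<in> Arr C; h \<in> Arr C; Cod C f = Dom C g; Cod C g = Dom C h\<rbrakk>
          \<Longrightarrow> Comp C h (Comp C g f) = Comp C (Comp C h g) f"

definition is_iso :: "('o, 'a) category \<Rightarrow> 'a \<Rightarrow> bool" where
  "is_iso C f \<longleftrightarrow> f \<in> Arr C \<and>
     (\<exists>g \<in> Arr C. Dom C g = Cod C f \<and> Cod C g = Dom C f \<and>
        Comp C g f = Id C (Dom C f) \<and> Comp C f g = Id C (Cod C f))"

record ('o, 'a, 'p, 'b) cat_functor =
  fobj :: "'o \<Rightarrow> 'p"
  farr :: "'a \<Rightarrow> 'b"

definition is_functor ::
    "('o, 'a) category \<Rightarrow> ('p, 'b) category \<Rightarrow> ('o, 'a, 'p, 'b) cat_functor \<Rightarrow> bool" where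
  "is_functor C D F \<longleftrightarrow> category C \<and> category D \<and>
     (\<forall>X \<in> Obj C. fobj F X \<in> Obj D) \<and>
     (\<forall>f \<in> Arr C. farr F f \<in> Arr D \<and>
        Dom D (farr F f) = fobj F (Dom C f) \<and> Cod D (farr F f) = fobj F (Cod C f)) \<and>
     (\<forall>X \<in> Obj C. farr F (Id C X) = Id D (fobj F X)) \<and>
     (\<forall>f \<in> Arr C. \<forall>g \<in> Arr C. Cod C f = Dom C g \<longrightarrow>
        farr F (Comp C g f) = Comp D (farr F g) (farr F f))"

definition id_functor :: "('o, 'a, 'o, 'a) cat_functor" where
  "id_functor = \<lparr>fobj = (\<lambda>X. X), farr = (\<lambda>f. f)\<rparr>"

definition comp_functor ::
    "('p, 'b, 'q, 'c) cat_functor \<Rightarrow> ('o, 'a, 'p, 'b) cat_functor \<Rightarrow> ('o, 'a, 'q, 'c) cat_functor" where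
  "comp_functor G F = \<lparr>fobj = (\<lambda>X. fobj G (fobj F X)), farr = (\<lambda>f. farr G (farr F f))\<rparr>"

definition naturally_isomorphic ::
    "('o, 'a) category \<Rightarrow> ('p, 'b) category \<Rightarrow>
     ('o, 'a, 'p, 'b) cat_functor \<Rightarrow> ('o, 'a, 'p, 'b) cat_functor \<Rightarrow> bool" where
  "naturally_isomorphic C D F G \<longleftrightarrow> is_functor C D F \<and> is_functor C D G \<and>
     (\<exists>\<eta>. (\<forall>X \<in> Obj C. is_iso D (\<eta> X) \<and> Dom D (\<eta> X) = fobj F X \<and> Cod D (\<eta> X) = fobj G X) \<and>
          (\<forall>f \<in> Arr C. Comp D (\<eta> (Cod C f)) (farr F f) = Comp D (farr G f) (\<eta> (Dom C f))))"

definition is_equivalence ::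
    "('o, 'a) category \<Rightarrow> ('p, 'b) category \<Rightarrow> ('o, 'a, 'p, 'b) cat_functor \<Rightarrow> bool" where
  "is_equivalence C D F \<longleftrightarrow> is_functor C D F \<and>
     (\<exists>G. is_functor D C G \<and>
          naturally_isomorphic C C (comp_functor G F) id_functor \<and>
          naturally_isomorphic D D (comp_functor F G) id_functor)"

text \<open>The universe of sets is the powerset of a type \<open>'x\<close>. Functions are extensional, so that
  equality of arrows is equality of functions on the domain.\<close>

definition Set_cat :: "('x set, 'x set \<times> ('x \<Rightarrow> 'x) \<times> 'x set) category" where
  "Set_cat = \<lparr>Obj = UNIV,
     Arr = {(A, f, B). f \<in> A \<rightarrow>\<^sub>E B},
     Dom = (\<lambda>(A, f, B). A),
     Cod = (\<lambda>(A, f, B). B),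
     Id = (\<lambda>A. (A, (\<lambda>x\<in>A. x), A)),
     Comp = (\<lambda>(B, g, C) (A, f, B'). (A, compose A g f, C))\<rparr>"

section \<open>The category of continuous actions and its canonical point\<close>

record ('x, 'm) right_set =
  Car :: "'x set"
  act :: "'x \<times> 'm \<Rightarrow> 'x"

definition is_right_set :: "('m, 'b) monoid_scheme \<Rightarrow> ('x, 'm) right_set \<Rightarrow> bool" where
  "is_right_set M X \<longleftrightarrow> act X \<in> Car X \<times> carrier M \<rightarrow>\<^sub>E Car X \<and>
     (\<forall>x \<in> Car X. act X (x, \<one>\<^bsub>M\<^esub>) = x) \<and>
     (\<forall>x \<in> Car X. \<forall>m \<in> carrier M. \<forall>n \<in> carrier M.
        act X (x, m \<otimes>\<^bsub>M\<^esub> n) = act X (act X (x, m), n))"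

definition is_cont_set ::
    "('m, 'b) monoid_scheme \<Rightarrow> 'm topology \<Rightarrow> ('x, 'm) right_set \<Rightarrow> bool" where
  "is_cont_set M \<tau> X \<longleftrightarrow> is_right_set M X \<and>
     continuous_map (prod_topology (discrete_topology (Car X)) \<tau>) (discrete_topology (Car X)) (act X)"

definition equivariant ::
    "('m, 'b) monoid_scheme \<Rightarrow> ('x, 'm) right_set \<Rightarrow> ('x, 'm) right_set \<Rightarrow> ('x \<Rightarrow> 'x) \<Rightarrow> bool" where
  "equivariant M X Y f \<longleftrightarrow> f \<in> Car X \<rightarrow>\<^sub>E Car Y \<and>
     (\<forall>x \<in> Car X. \<forall>m \<in> carrier M. f (act X (x, m)) = act Y (f x, m))"

definition Cont ::
    "('m, 'b) monoid_scheme \<Rightarrow> 'm topology \<Rightarrow>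
     (('x, 'm) right_set, ('x, 'm) right_set \<times> ('x \<Rightarrow> 'x) \<times> ('x, 'm) right_set) category" where
  "Cont M \<tau> = \<lparr>Obj = {X. is_cont_set M \<tau> X},
     Arr = {(X, f, Y). is_cont_set M \<tau> X \<and> is_cont_set M \<tau> Y \<and> equivariant M X Y f},
     Dom = (\<lambda>(X, f, Y). X),
     Cod = (\<lambda>(X, f, Y). Y),
     Id = (\<lambda>X. (X, (\<lambda>x\<in>Car X. x), X)),
     Comp = (\<lambda>(Y, g, Z) (X, f, Y'). (X, compose (Car X) g f, Z))\<rparr>"

text \<open>The inverse image functor of the canonical point of \<open>Cont M \<tau>\<close>, from \<open>Cont M \<tau>\<close> to
  \<open>Set_cat\<close>. An isomorphism of geometric morphisms is a natural isomorphism of their inverse image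
  functors, so this is the datum through which canonical points are compared.\<close>

definition point_inverse_image ::
    "(('x, 'm) right_set, ('x, 'm) right_set \<times> ('x \<Rightarrow> 'x) \<times> ('x, 'm) right_set,
      'x set, 'x set \<times> ('x \<Rightarrow> 'x) \<times> 'x set) cat_functor" where
  "point_inverse_image = \<lparr>fobj = Car, farr = (\<lambda>(X, f, Y). (Car X, f, Car Y))\<rparr>"

section \<open>Action topologies and powder monoids\<close>

definition translate :: "('m, 'b) monoid_scheme \<Rightarrow> 'm \<Rightarrow> 'm set \<Rightarrow> 'm set" where
  "translate M p A = {m \<in> carrier M. p \<otimes>\<^bsub>M\<^esub> m \<in> A}"  \<comment> \<open>\<open>p\<^sup>*(A)\<close>\<close>

definition same_translate :: "('m, 'b) monoid_scheme \<Rightarrow> 'm \<Rightarrow> 'm set \<Rightarrow> 'm set" where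
  "same_translate M p A = {m \<in> carrier M. translate M m A = translate M p A}"  \<comment> \<open>\<open>\<I>\<^sub>A\<^sup>p\<close>\<close>

definition action_base :: "('m, 'b) monoid_scheme \<Rightarrow> 'm topology \<Rightarrow> 'm set set" where
  "action_base M \<sigma> = {A. A \<subseteq> carrier M \<and>
     (\<forall>p \<in> carrier M. \<forall>q \<in> carrier M. openin \<sigma> (same_translate M p (translate M q A)))}"

definition action_topology :: "('m, 'b) monoid_scheme \<Rightarrow> 'm topology \<Rightarrow> 'm topology" where
  "action_topology M \<sigma> = topology (arbitrary union_of (\<lambda>A. A \<in> action_base M \<sigma>))"

text \<open>\<open>topology\<close> is only meaningful on predicates satisfying \<open>istopology\<close>; this is the case here.\<close>

lemma action_base_Int:
  assumes A: "A \<in> action_base M \<sigma>" and B: "B \<in> action_base M \<sigma>"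
  shows "A \<inter> B \<in> action_base M \<sigma>"
proof -
  have "openin \<sigma> (same_translate M p (translate M q (A \<inter> B)))"
    if p: "p \<in> carrier M" and q: "q \<in> carrier M" for p q
  proof (subst openin_subopen, intro ballI)
    fix m assume m: "m \<in> same_translate M p (translate M q (A \<inter> B))"
    let ?U = "same_translate M m (translate M q A) \<inter> same_translate M m (translate M q B)"
    have mM: "m \<in> carrier M"
      using m by (simp add: same_translate_def)
    then have "openin \<sigma> ?U"
      using A B q by (simp add: action_base_def openin_Int)
    moreover have "m \<in> ?U"
      using mM by (simp add: same_translate_def)
    moreover have "translate M n (translate M q (A \<inter> B)) =
        translate M n (translate M q A) \<inter> translate M n (translate M q B)" for n
      by (auto simp: translate_def)
    then have "?U \<subseteq> same_translate M p (translate M q (A \<inter> B))"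
      using m unfolding same_translate_def by auto
    ultimately show "\<exists>T. openin \<sigma> T \<and> m \<in> T \<and> T \<subseteq> same_translate M p (translate M q (A \<inter> B))"
      by blast
  qed
  then show ?thesis
    using A by (auto simp: action_base_def)
qed

lemma openin_action_topology:
  "openin (action_topology M \<sigma>) = arbitrary union_of (\<lambda>A. A \<in> action_base M \<sigma>)"
  unfolding action_topology_def
  by (intro topology_inverse' istopology_base action_base_Int)

definition topological_monoid :: "('m, 'b) monoid_scheme \<Rightarrow> 'm topology \<Rightarrow> bool" where
  "topological_monoid M \<tau> \<longleftrightarrow> Group.monoid M \<and> topspace \<tau> = carrier M \<and>
     continuous_map (prod_topology \<tau> \<tau>) \<tau> (\<lambda>(m, n). m \<otimes>\<^bsub>M\<^esub> n)"

definition powder_monoid :: "('m, 'b) monoid_scheme \<Rightarrow> 'm topology \<Rightarrow> bool" where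
  "powder_monoid M \<tau> \<longleftrightarrow>
     topological_monoid M \<tau> \<and> t0_space \<tau> \<and> action_topology M \<tau> = \<tau>"

section \<open>The canonical powder monoid of a monoid with a topology\<close>

text \<open>Replace the topology by the action topology it induces and take the Kolmogorov quotient.
  Equivalence classes are used instead of \<^const>\<open>Kolmogorov_quotient\<close>, which
  selects representatives by choice.\<close>

definition indistinguishable :: "('m, 'b) monoid_scheme \<Rightarrow> 'm topology \<Rightarrow> ('m \<times> 'm) set" where
  "indistinguishable M \<tau> = {(m, n) \<in> carrier M \<times> carrier M.
     \<forall>U. openin (action_topology M \<tau>) U \<longrightarrow> (m \<in> U \<longleftrightarrow> n \<in> U)}"

text \<open>The elementwise product of two classes need not be a whole class, hence it is saturated.\<close>

definition powder_quotient :: "('m, 'b) monoid_scheme \<Rightarrow> 'm topology \<Rightarrow> 'm set monoid" where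
  "powder_quotient M \<tau> = \<lparr>carrier = carrier M // indistinguishable M \<tau>,
     mult = (\<lambda>K L. indistinguishable M \<tau> `` (K <#>\<^bsub>M\<^esub> L)),
     one = indistinguishable M \<tau> `` {\<one>\<^bsub>M\<^esub>}\<rparr>"

text \<open>The quotient topology of the action topology.\<close>

definition powder_topology :: "('m, 'b) monoid_scheme \<Rightarrow> 'm topology \<Rightarrow> 'm set topology" where
  "powder_topology M \<tau> = topology (\<lambda>V. V \<subseteq> carrier (powder_quotient M \<tau>) \<and>
     openin (action_topology M \<tau>) (\<Union>V))"

lemma equiv_indistinguishable: "equiv (carrier M) (indistinguishable M \<tau>)"
  by (rule equivI) (auto simp: indistinguishable_def refl_on_def sym_def trans_def)

lemma openin_powder_topology:
  "openin (powder_topology M \<tau>) V \<longleftrightarrow>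
     V \<subseteq> carrier (powder_quotient M \<tau>) \<and> openin (action_topology M \<tau>) (\<Union>V)"
proof -
  have Int: "\<Union>(S \<inter> T) = \<Union>S \<inter> \<Union>T"
    if "S \<subseteq> carrier (powder_quotient M \<tau>)" "T \<subseteq> carrier (powder_quotient M \<tau>)" for S T
  proof (intro subset_antisym subsetI)
    fix x assume "x \<in> \<Union>S \<inter> \<Union>T"
    then obtain K L where K: "K \<in> S" "x \<in> K" and L: "L \<in> T" "x \<in> L"
      by blast
    then have "K = L"
      using that quotient_disj [OF equiv_indistinguishable, of K M \<tau> L]
      by (auto simp: powder_quotient_def)
    then show "x \<in> \<Union>(S \<inter> T)"
      using K L by blast
  qed blast
  have Un: "\<Union>(\<Union>\<K>) = \<Union>(Union ` \<K>)" for \<K> :: "'a set set set"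
    by blast
  have "istopology (\<lambda>V. V \<subseteq> carrier (powder_quotient M \<tau>) \<and>
     openin (action_topology M \<tau>) (\<Union>V))"
    unfolding istopology_def
  proof (intro conjI allI impI)
    fix \<K> assume "\<forall>K\<in>\<K>. K \<subseteq> carrier (powder_quotient M \<tau>) \<and> openin (action_topology M \<tau>) (\<Union>K)"
    then show "openin (action_topology M \<tau>) (\<Union>(\<Union>\<K>))"
      unfolding Un by (intro openin_Union) blast
  qed (auto simp: Int)
  then show ?thesis
    by (simp add: powder_topology_def topology_inverse')
qed

end

theory Submission
  imports Defs
begin

text \<open>For a continuous right \<open>M\<close>-set \<open>X\<close> the sets \<open>{m. x m = y}\<close> belong to the base of the action
  topology, so elements of \<open>M\<close> that the action topology does not separate act identically on \<open>X\<close>.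
  Conversely, every base set \<open>A\<close> is a union of sets \<open>\<I>\<^sub>A\<^sup>a\<close> and hence open in the original topology.
  Actions therefore factor uniquely through the Kolmogorov quotient, and the equivalence is even an
  isomorphism of categories that keeps underlying sets. The quotient is a powder monoid because the
  sets \<open>\<I>\<^sub>A\<^sup>p\<close> and \<open>p\<^sup>*(A)\<close> of a base set \<open>A\<close> are base sets again: as
  \<open>\<I>\<^sub>A\<^sup>p \<cdot> p\<^sup>*(A) \<subseteq> A\<close>, multiplication is continuous, and passing to the action topology is
  idempotent.\<close>

section \<open>Categories\<close>

lemma is_iso_Id:
  assumes "category C" and "X \<in> Obj C"
  shows "is_iso C (Id C X)"
proof -
  interpret category C by fact
  have "Comp C (Id C X) (Id C X) = Id C X"
    using Comp_Id_right [OF Id_closed] Dom_Id assms by metis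
  then show ?thesis
    using assms unfolding is_iso_def
    by (auto simp: Id_closed Dom_Id Cod_Id intro!: bexI [of _ "Id C X"])
qed

text \<open>Identity arrows serve as components. Agreement is asked for only on \<open>C\<close>,
  since the fields of a functor record are total functions with arbitrary values elsewhere.\<close>

lemma naturally_isomorphic_eqI:
  assumes F: "is_functor C D F" and G: "is_functor C D G"
    and obj: "\<And>X. X \<in> Obj C \<Longrightarrow> fobj F X = fobj G X"
    and arr: "\<And>f. f \<in> Arr C \<Longrightarrow> farr F f = farr G f"
  shows "naturally_isomorphic C D F G"
proof -
  interpret C: category C using F by (simp add: is_functor_def)
  interpret D: category D using F by (simp add: is_functor_def)
  have "Comp D (Id D (fobj F (Cod C f))) (farr F f) = Comp D (farr G f) (Id D (fobj F (Dom C f)))"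
    if "f \<in> Arr C" for f
  proof -
    have "farr F f \<in> Arr D" "Dom D (farr F f) = fobj F (Dom C f)" "Cod D (farr F f) = fobj F (Cod C f)"
      using F that by (auto simp: is_functor_def)
    then show ?thesis
      using D.Comp_Id_left D.Comp_Id_right arr [OF that] by metis
  qed
  moreover have "is_iso D (Id D (fobj F X)) \<and> Dom D (Id D (fobj F X)) = fobj F X \<and>
      Cod D (Id D (fobj F X)) = fobj G X" if "X \<in> Obj C" for X
  proof -
    have "fobj F X \<in> Obj D" using F that by (simp add: is_functor_def)
    then show ?thesis
      using is_iso_Id [OF D.category_axioms] obj [OF that] by (simp add: D.Dom_Id D.Cod_Id)
  qed
  ultimately show ?thesis
    unfolding naturally_isomorphic_def using F G
    by (intro conjI exI [of _ "\<lambda>X. Id D (fobj F X)"]) auto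
qed

lemma is_functor_id: "category C \<Longrightarrow> is_functor C C id_functor"
  by (auto simp: is_functor_def id_functor_def)

lemma is_functor_comp:
  assumes F: "is_functor C D F" and G: "is_functor D E G"
  shows "is_functor C E (comp_functor G F)"
proof -
  have "category C" "category D" "category E"
    using F G by (auto simp: is_functor_def)
  then show ?thesis
    using F G by (auto simp: is_functor_def comp_functor_def)
qed

lemma is_equivalenceI_inverse:
  assumes F: "is_functor C D F" and G: "is_functor D C G"
    and "\<And>X. X \<in> Obj C \<Longrightarrow> fobj G (fobj F X) = X"
    and "\<And>f. f \<in> Arr C \<Longrightarrow> farr G (farr F f) = f"
    and "\<And>Y. Y \<in> Obj D \<Longrightarrow> fobj F (fobj G Y) = Y"
    and "\<And>g. g \<in> Arr D \<Longrightarrow> farr F (farr G g) = g"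
  shows "is_equivalence C D F"
proof -
  have "category C" "category D"
    using F by (auto simp: is_functor_def)
  then have "naturally_isomorphic C C (comp_functor G F) id_functor"
    "naturally_isomorphic D D (comp_functor F G) id_functor"
    using naturally_isomorphic_eqI [OF is_functor_comp [OF F G] is_functor_id]
      naturally_isomorphic_eqI [OF is_functor_comp [OF G F] is_functor_id] assms(3-)
    by (auto simp: comp_functor_def id_functor_def)
  then show ?thesis
    using F G by (auto simp: is_equivalence_def)
qed

section \<open>Extensional functions and the categories built from them\<close>

lemma compose_closed_PiE: "f \<in> A \<rightarrow>\<^sub>E B \<Longrightarrow> g \<in> B \<rightarrow>\<^sub>E C \<Longrightarrow> compose A g f \<in> A \<rightarrow>\<^sub>E C"
  by (auto simp: compose_def PiE_def)

lemma compose_restrict_id_left: "f \<in> A \<rightarrow>\<^sub>E B \<Longrightarrow> compose A (\<lambda>x\<in>B. x) f = f"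
  by (rule ext) (auto simp: compose_def PiE_def extensional_def)

lemma compose_restrict_id_right: "f \<in> A \<rightarrow>\<^sub>E B \<Longrightarrow> compose A f (\<lambda>x\<in>A. x) = f"
  by (rule ext) (auto simp: compose_def PiE_def extensional_def)

text \<open>\<open>f\<close> takes values in \<open>B\<close> on \<open>A\<close>, so the inner
  restriction to \<open>B\<close> is invisible there; off \<open>A\<close> both sides are
  \<open>undefined\<close>.\<close>

lemma compose_assoc_PiE: "f \<in> A \<rightarrow>\<^sub>E B \<Longrightarrow> compose A h (compose A g f) = compose A (compose B h g) f"
  by (rule ext) (auto simp: compose_def PiE_def)

lemma category_Set_cat: "category Set_cat"
  unfolding category_def Set_cat_def
  by (auto simp del: PiE_iff intro: compose_closed_PiE [THEN PiE_mem]
      compose_closed_PiE [THEN PiE_arb] compose_restrict_id_left compose_restrict_id_right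
      compose_assoc_PiE)

lemma equivariantD: "equivariant M X Y f \<Longrightarrow> f \<in> Car X \<rightarrow>\<^sub>E Car Y"
  by (simp add: equivariant_def)

lemma equivariant_id: "is_right_set M X \<Longrightarrow> equivariant M X X (\<lambda>x\<in>Car X. x)"
  by (auto simp: equivariant_def is_right_set_def PiE_def)

lemma equivariant_compose:
  assumes "is_right_set M X" and "equivariant M X Y f" and "equivariant M Y Z g"
  shows "equivariant M X Z (compose (Car X) g f)"
proof -
  have "act X (x, m) \<in> Car X" "f x \<in> Car Y" if "x \<in> Car X" "m \<in> carrier M" for x m
    using assms that by (auto simp: is_right_set_def equivariant_def)
  then show ?thesis
    using assms compose_closed_PiE [of f "Car X" "Car Y" g "Car Z"] unfolding equivariant_def
    by (simp add: compose_eq)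
qed

lemma category_Cont: "category (Cont M \<tau>)"
  unfolding category_def Cont_def
  by (auto simp: is_cont_set_def intro: equivariant_id equivariant_compose
      compose_restrict_id_left compose_restrict_id_right compose_assoc_PiE dest: equivariantD)

lemma is_functor_point_inverse_image: "is_functor (Cont M \<tau>) Set_cat point_inverse_image"
  using category_Cont category_Set_cat
  by (auto simp: is_functor_def Cont_def Set_cat_def point_inverse_image_def equivariant_def)

section \<open>Continuous actions\<close>

text \<open>Discreteness of the first factor allows fixing \<open>x\<close>, and discreteness of the
  codomain reduces preimages to fibres over single points.\<close>

lemma continuous_map_prod_discrete_iff:
  assumes "f \<in> A \<times> topspace \<tau> \<rightarrow> B"
  shows "continuous_map (prod_topology (discrete_topology A) \<tau>) (discrete_topology B) f \<longleftrightarrow>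
    (\<forall>x\<in>A. \<forall>y\<in>B. openin \<tau> {m \<in> topspace \<tau>. f (x, m) = y})" (is "?L \<longleftrightarrow> ?R")
proof
  assume L: ?L
  show ?R
  proof (intro ballI)
    fix x y assume "x \<in> A" "y \<in> B"
    have "continuous_map \<tau> (prod_topology (discrete_topology A) \<tau>) (\<lambda>m. (x, m))"
      using \<open>x \<in> A\<close> by (intro continuous_map_pairedI) auto
    then have "continuous_map \<tau> (discrete_topology B) (\<lambda>m. f (x, m))"
      using L continuous_map_compose by (fastforce simp: o_def)
    then have "openin \<tau> {m \<in> topspace \<tau>. f (x, m) \<in> {y}}"
      using \<open>y \<in> B\<close> by (intro openin_continuous_map_preimage) auto
    then show "openin \<tau> {m \<in> topspace \<tau>. f (x, m) = y}"
      by simp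
  qed
next
  assume R: ?R
  \<comment> \<open>The box is \<open>{x}\<close> times the fibre through \<open>m\<close> of the
    slice of \<open>f\<close> at \<open>x\<close>.\<close>
  have "\<exists>V W. openin (discrete_topology A) V \<and> openin \<tau> W \<and> x \<in> V \<and> m \<in> W \<and>
      V \<times> W \<subseteq> {z \<in> A \<times> topspace \<tau>. f z \<in> U}"
    if "x \<in> A" "m \<in> topspace \<tau>" "f (x, m) \<in> U" for x m U
    using that R assms
    by (intro exI [of _ "{x}"] exI [of _ "{n \<in> topspace \<tau>. f (x, n) = f (x, m)}"]) auto
  then show ?L
    using assms by (auto simp: continuous_map_def openin_prod_topology_alt)
qed

lemma is_cont_set_iff:
  assumes "topspace \<tau> = carrier M"
  shows "is_cont_set M \<tau> X \<longleftrightarrow> is_right_set M X \<and>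
    (\<forall>x\<in>Car X. \<forall>y\<in>Car X. openin \<tau> {m \<in> carrier M. act X (x, m) = y})"
proof -
  have "act X \<in> Car X \<times> topspace \<tau> \<rightarrow> Car X" if "is_right_set M X"
    using that assms by (auto simp: is_right_set_def)
  then show ?thesis
    using continuous_map_prod_discrete_iff [of "act X" "Car X" \<tau> "Car X"] assms
    by (auto simp: is_cont_set_def)
qed

section \<open>Action topologies\<close>

locale monoid_with_topology = Group.monoid M
  for M :: "('m, 'b) monoid_scheme" (structure) and \<tau> :: "'m topology" +
  assumes topspace_eq: "topspace \<tau> = carrier M"
begin

lemma translate_translate:
  "p \<in> carrier M \<Longrightarrow> q \<in> carrier M \<Longrightarrow> translate M p (translate M q A) = translate M (q \<otimes> p) A"
  by (auto simp: translate_def m_assoc)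

lemma mem_same_translate: "p \<in> carrier M \<Longrightarrow> p \<in> same_translate M p A"
  by (simp add: same_translate_def)

text \<open>Membership in \<open>A\<close> can be read off the translate: \<open>m\<close> lies in
  \<open>A\<close> iff \<open>\<one>\<close> lies in \<open>translate M m A\<close>.\<close>

lemma same_translate_subset:
  assumes "A \<subseteq> carrier M" and "a \<in> A"
  shows "same_translate M a A \<subseteq> A"
proof
  fix m assume "m \<in> same_translate M a A"
  then have "m \<in> carrier M" "\<one> \<in> translate M m A"
    using assms by (auto simp: same_translate_def translate_def)
  then show "m \<in> A"
    by (simp add: translate_def)
qed

lemma translate_one: "A \<subseteq> carrier M \<Longrightarrow> translate M \<one> A = A"
  by (auto simp: translate_def)

lemma action_base_imp_openin:
  assumes "A \<in> action_base M \<tau>"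
  shows "openin \<tau> A"
proof (subst openin_subopen, intro ballI)
  fix a assume "a \<in> A"
  have sub: "A \<subseteq> carrier M"
    using assms by (simp add: action_base_def)
  \<comment> \<open>The case \<open>q = \<one>\<close> of the base condition, which speaks about
    \<open>A\<close> itself.\<close>
  with \<open>a \<in> A\<close> have "openin \<tau> (same_translate M a (translate M \<one> A))"
    using assms by (auto simp: action_base_def)
  then have "openin \<tau> (same_translate M a A)"
    using sub by (simp add: translate_one)
  moreover have "a \<in> same_translate M a A"
    using sub \<open>a \<in> A\<close> by (auto intro: mem_same_translate)
  ultimately show "\<exists>T. openin \<tau> T \<and> a \<in> T \<and> T \<subseteq> A"
    using same_translate_subset [OF sub \<open>a \<in> A\<close>] by blast
qed

lemma openin_action_topology_iff:
  "openin (action_topology M \<tau>) U \<longleftrightarrow> (\<forall>x\<in>U. \<exists>A\<in>action_base M \<tau>. x \<in> A \<and> A \<subseteq> U)"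
  unfolding openin_action_topology
  by (subst arbitrary_union_of_alt) blast

lemma action_base_openin_action_topology:
  "A \<in> action_base M \<tau> \<Longrightarrow> openin (action_topology M \<tau>) A"
  by (auto simp: openin_action_topology_iff)

lemma openin_action_topology_imp_openin:
  "openin (action_topology M \<tau>) U \<Longrightarrow> openin \<tau> U"
  using action_base_imp_openin by (subst openin_subopen) (force simp: openin_action_topology_iff)

lemma carrier_in_action_base: "carrier M \<in> action_base M \<tau>"
proof -
  have "same_translate M p (translate M q (carrier M)) = topspace \<tau>"
    if "p \<in> carrier M" "q \<in> carrier M" for p q
    using that by (auto simp: same_translate_def translate_def topspace_eq)
  then show ?thesis
    by (simp add: action_base_def)
qed

lemma topspace_action_topology: "topspace (action_topology M \<tau>) = carrier M"
proof
  show "topspace (action_topology M \<tau>) \<subseteq> carrier M"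
    using openin_action_topology_imp_openin [OF openin_topspace] openin_subset topspace_eq by metis
  show "carrier M \<subseteq> topspace (action_topology M \<tau>)"
    using carrier_in_action_base action_base_openin_action_topology openin_subset by blast
qed

section \<open>Closure properties of the base and continuity of multiplication\<close>

lemma translate_in_action_base:
  assumes "A \<in> action_base M \<tau>" and "r \<in> carrier M"
  shows "translate M r A \<in> action_base M \<tau>"
  using assms by (auto simp: action_base_def translate_translate) (auto simp: translate_def)

text \<open>Under \<open>refine\<close>, each set
  \<open>same_translate M p (translate M q B)\<close> is a union of sets
  \<open>same_translate M k (translate M q A)\<close>, which are open.\<close>

lemma action_baseI_refine:
  assumes A: "A \<in> action_base M \<tau>" and B: "B \<subseteq> carrier M"
    and refine: "\<And>k k'. \<lbrakk>k \<in> carrier M; k' \<in> carrier M; translate M k A = translate M k' A\<rbrakk>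
       \<Longrightarrow> translate M k B = translate M k' B"
  shows "B \<in> action_base M \<tau>"
proof -
  have "openin \<tau> (same_translate M p (translate M q B))"
    if p: "p \<in> carrier M" and q: "q \<in> carrier M" for p q
  proof (subst openin_subopen, intro ballI)
    fix k assume k: "k \<in> same_translate M p (translate M q B)"
    then have kM: "k \<in> carrier M"
      by (simp add: same_translate_def)
    have "translate M k' (translate M q B) = translate M k (translate M q B)"
      if "k' \<in> same_translate M k (translate M q A)" for k'
    proof -
      \<comment> \<open>\<open>refine\<close> speaks of \<open>A\<close>, so translating
        \<open>translate M q A\<close> by \<open>k\<close> is rewritten as translating
        \<open>A\<close> by \<open>q \<otimes> k\<close>.\<close>
      have k': "k' \<in> carrier M" and "translate M (q \<otimes> k') A = translate M (q \<otimes> k) A"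
        using that translate_translate [of k' q A] translate_translate [OF kM q, of A] q
        by (simp_all add: same_translate_def)
      then have "translate M (q \<otimes> k') B = translate M (q \<otimes> k) B"
        using kM q by (intro refine) auto
      then show ?thesis
        using translate_translate [OF k' q, of B] translate_translate [OF kM q, of B] by metis
    qed
    then have "same_translate M k (translate M q A) \<subseteq> same_translate M p (translate M q B)"
      using k by (auto simp: same_translate_def)
    moreover have "openin \<tau> (same_translate M k (translate M q A))"
      using A kM q by (simp add: action_base_def)
    ultimately show "\<exists>T. openin \<tau> T \<and> k \<in> T \<and> T \<subseteq> same_translate M p (translate M q B)"
      using mem_same_translate [OF kM] by blast
  qed
  then show ?thesis
    using B by (simp add: action_base_def)
qed

text \<open>\<open>translate M k A\<close> determines \<open>translate M (k \<otimes> n) A\<close>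
  for every \<open>n\<close>, hence also which \<open>n\<close> satisfy
  \<open>k \<otimes> n \<in> same_translate M r A\<close>.\<close>

lemma same_translate_in_action_base:
  assumes "A \<in> action_base M \<tau>" and r: "r \<in> carrier M"
  shows "same_translate M r A \<in> action_base M \<tau>"
proof (rule action_baseI_refine [OF assms(1)])
  fix k k' assume "k \<in> carrier M" "k' \<in> carrier M" and eq: "translate M k A = translate M k' A"
  then have "translate M (k \<otimes> n) A = translate M (k' \<otimes> n) A" if "n \<in> carrier M" for n
    using that by (metis translate_translate)
  with \<open>k \<in> carrier M\<close> \<open>k' \<in> carrier M\<close>
  show "translate M k (same_translate M r A) = translate M k' (same_translate M r A)"
    unfolding translate_def [of M _ "same_translate M r A"] by (auto simp: same_translate_def)
qed (auto simp: same_translate_def)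

lemma continuous_mult_action_topology:
  assumes U: "openin (action_topology M \<tau>) U" and m: "m \<in> carrier M" and n: "n \<in> carrier M"
    and mn: "m \<otimes> n \<in> U"
  obtains V W where "openin (action_topology M \<tau>) V" "openin (action_topology M \<tau>) W"
    "m \<in> V" "n \<in> W" "\<forall>m'\<in>V. \<forall>n'\<in>W. m' \<otimes> n' \<in> U"
proof -
  obtain A where A: "A \<in> action_base M \<tau>" "m \<otimes> n \<in> A" "A \<subseteq> U"
    using U mn by (auto simp: openin_action_topology_iff)
  show thesis
  proof (rule that)
    show "openin (action_topology M \<tau>) (same_translate M m A)"
      "openin (action_topology M \<tau>) (translate M m A)"
      using A m same_translate_in_action_base translate_in_action_base
        action_base_openin_action_topology by auto
    show "m \<in> same_translate M m A" "n \<in> translate M m A"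
      using A m n by (auto simp: same_translate_def translate_def)
    \<comment> \<open>Here \<open>n'\<close> lies in
      \<open>translate M m A = translate M m' A\<close>, which means
      \<open>m' \<otimes> n' \<in> A\<close>.\<close>
    show "\<forall>m'\<in>same_translate M m A. \<forall>n'\<in>translate M m A. m' \<otimes> n' \<in> U"
      using A by (auto simp: same_translate_def translate_def)
  qed
qed

text \<open>The translate of \<open>?A\<close> by \<open>q \<otimes> m\<close> depends on
  \<open>m\<close> only through the point of \<open>X\<close> reached from \<open>x\<close> by
  \<open>q \<otimes> m\<close>. The target \<open>y\<close> may lie outside \<open>Car X\<close>:
  openness is used only for fibres over points that are reached.\<close>

lemma action_fibre_in_action_base:
  assumes X: "is_cont_set M \<tau> X" and x: "x \<in> Car X"
  shows "{m \<in> carrier M. act X (x, m) = y} \<in> action_base M \<tau>" (is "?A \<in> _")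
proof -
  have XR: "is_right_set M X"
    and op: "\<And>x y. \<lbrakk>x \<in> Car X; y \<in> Car X\<rbrakk> \<Longrightarrow> openin \<tau> {m \<in> carrier M. act X (x, m) = y}"
    using X by (auto simp: is_cont_set_iff topspace_eq)
  have act_closed: "act X (x, m) \<in> Car X" if "x \<in> Car X" "m \<in> carrier M" for x m
    using XR that by (auto simp: is_right_set_def)
  have act_mult: "act X (x, m \<otimes> n) = act X (act X (x, m), n)"
    if "x \<in> Car X" "m \<in> carrier M" "n \<in> carrier M" for x m n
    using XR that by (auto simp: is_right_set_def)
  have "openin \<tau> (same_translate M p (translate M q ?A))"
    if p: "p \<in> carrier M" and q: "q \<in> carrier M" for p q
  proof (subst openin_subopen, intro ballI)
    fix m assume m: "m \<in> same_translate M p (translate M q ?A)"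
    then have mM: "m \<in> carrier M"
      by (simp add: same_translate_def)
    let ?T = "{m' \<in> carrier M. act X (act X (x, q), m') = act X (act X (x, q), m)}"
    have "translate M m' (translate M q ?A) = translate M m (translate M q ?A)" if "m' \<in> ?T" for m'
      using that mM q x by (auto simp: translate_def act_mult act_closed)
    then have "?T \<subseteq> same_translate M p (translate M q ?A)"
      using m by (auto simp: same_translate_def)
    moreover have "openin \<tau> ?T" "m \<in> ?T"
      using mM q x by (auto intro!: op act_closed)
    ultimately show "\<exists>T. openin \<tau> T \<and> m \<in> T \<and> T \<subseteq> same_translate M p (translate M q ?A)"
      by blast
  qed
  then show ?thesis
    by (auto simp: action_base_def)
qed

section \<open>The powder quotient\<close>

definition cls :: "'m \<Rightarrow> 'm set" where
  "cls m = indistinguishable M \<tau> `` {m}"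

abbreviation Q :: "'m set monoid" where
  "Q \<equiv> powder_quotient M \<tau>"

lemma cls_eq_iff: "m \<in> carrier M \<Longrightarrow> n \<in> carrier M \<Longrightarrow>
    cls m = cls n \<longleftrightarrow> (\<forall>U. openin (action_topology M \<tau>) U \<longrightarrow> (m \<in> U \<longleftrightarrow> n \<in> U))"
  unfolding cls_def
  by (subst eq_equiv_class_iff [OF equiv_indistinguishable]) (auto simp: indistinguishable_def)

lemma mem_cls_iff: "m \<in> carrier M \<Longrightarrow> n \<in> cls m \<longleftrightarrow> n \<in> carrier M \<and> cls m = cls n"
  unfolding cls_def by (metis Image_singleton_iff equiv_class_eq_iff equiv_indistinguishable)

lemma carrier_Q: "carrier Q = cls ` carrier M"
  by (auto simp: powder_quotient_def quotient_def cls_def)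

text \<open>By continuity of multiplication, an open \<open>U\<close> around
  \<open>m \<otimes> n\<close> contains all products from some open \<open>V\<close> around
  \<open>m\<close> and \<open>W\<close> around \<open>n\<close>; these contain \<open>m'\<close> and
  \<open>n'\<close> as well.\<close>

lemma cls_mult_cong:
  assumes "m \<in> carrier M" "m' \<in> carrier M" "cls m = cls m'"
    and "n \<in> carrier M" "n' \<in> carrier M" "cls n = cls n'"
  shows "cls (m \<otimes> n) = cls (m' \<otimes> n')"
proof -
  \<comment> \<open>One implication, general in all variables, so that it can be applied with the
    two pairs exchanged.\<close>
  have "m' \<otimes> n' \<in> U" if "openin (action_topology M \<tau>) U" "m \<otimes> n \<in> U"
    "m \<in> carrier M" "m' \<in> carrier M" "cls m = cls m'"
    "n \<in> carrier M" "n' \<in> carrier M" "cls n = cls n'" for U m n m' n'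
    using continuous_mult_action_topology [of U m n] that by (metis cls_eq_iff)
  then show ?thesis
    using assms by (subst cls_eq_iff) (simp_all, blast)
qed

lemma one_Q: "\<one>\<^bsub>Q\<^esub> = cls \<one>"
  by (simp add: powder_quotient_def cls_def)

text \<open>All products of representatives lie in one class, so saturating the elementwise product
  yields exactly that class.\<close>

lemma mult_cls:
  assumes m: "m \<in> carrier M" and n: "n \<in> carrier M"
  shows "cls m \<otimes>\<^bsub>Q\<^esub> cls n = cls (m \<otimes> n)"
proof -
  have "cls k = cls (m \<otimes> n)" if k: "k \<in> cls m <#> cls n" for k
  proof -
    from k obtain m' n' where "m' \<in> cls m" "n' \<in> cls n" "k = m' \<otimes> n'"
      unfolding set_mult_def by blast
    then show ?thesis
      using m n cls_mult_cong [of m m' n n'] by (simp add: mem_cls_iff)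
  qed
  \<comment> \<open>The index set of the union below must be nonempty for a constant union to equal
    its value.\<close>
  moreover have "m \<otimes> n \<in> cls m <#> cls n"
    using m n mem_cls_iff by (auto simp: set_mult_def)
  ultimately have "(\<Union>k \<in> cls m <#> cls n. cls k) = cls (m \<otimes> n)"
    by (intro SUP_eq_const) blast+
  then show ?thesis
    by (simp add: powder_quotient_def Image_eq_UN [of _ "cls m <#> cls n"] flip: cls_def)
qed

lemma monoid_Q: "Group.monoid Q"
  by unfold_locales (auto simp: carrier_Q mult_cls one_Q m_assoc)

lemma Union_classes:
  assumes "V \<subseteq> carrier Q"
  shows "\<Union>V = {m \<in> carrier M. cls m \<in> V}"
  using assms by (force simp: carrier_Q mem_cls_iff)

section \<open>The quotient topology\<close>

lemma openin_powder_iff: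
  "openin (powder_topology M \<tau>) V \<longleftrightarrow>
    V \<subseteq> carrier Q \<and> openin (action_topology M \<tau>) {m \<in> carrier M. cls m \<in> V}"
  using Union_classes by (auto simp: openin_powder_topology)

text \<open>Indistinguishable elements lie in the same open sets, so every open set is a union of
  classes. This makes \<open>cls\<close> an open map.\<close>

lemma saturated_openin_action_topology:
  assumes "openin (action_topology M \<tau>) U"
  shows "{m \<in> carrier M. cls m \<in> cls ` U} = U"
proof -
  have "U \<subseteq> carrier M"
    using assms openin_subset topspace_action_topology by metis
  then show ?thesis
    using assms by (auto simp: cls_eq_iff image_iff)
qed

lemma openin_cls_image:
  assumes "openin (action_topology M \<tau>) U"
  shows "openin (powder_topology M \<tau>) (cls ` U)"
  using assms openin_subset [OF assms]
  by (auto simp: openin_powder_iff saturated_openin_action_topology topspace_action_topology carrier_Q)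

lemma topspace_powder: "topspace (powder_topology M \<tau>) = carrier Q"
proof
  show "topspace (powder_topology M \<tau>) \<subseteq> carrier Q"
    using openin_topspace openin_powder_iff by blast
  show "carrier Q \<subseteq> topspace (powder_topology M \<tau>)"
    using openin_cls_image [of "carrier M"] openin_subset carrier_Q topspace_action_topology
      openin_topspace by metis
qed

text \<open>A product of quotient maps need not be a quotient map, but \<open>cls\<close> is open,
  so neighbourhoods found in \<open>M\<close> can be pushed forward to \<open>Q\<close>.\<close>

lemma topological_monoid_Q: "topological_monoid Q (powder_topology M \<tau>)"
proof -
  let ?P = "powder_topology M \<tau>"
  have "\<exists>V W. openin ?P V \<and> openin ?P W \<and> K \<in> V \<and> L \<in> W \<and>
      V \<times> W \<subseteq> {z \<in> carrier Q \<times> carrier Q. (case z of (m, n) \<Rightarrow> m \<otimes>\<^bsub>Q\<^esub> n) \<in> U}"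
    if U: "openin ?P U" and KL: "K \<in> carrier Q" "L \<in> carrier Q" "K \<otimes>\<^bsub>Q\<^esub> L \<in> U" for U K L
  proof -
    obtain m n where mn: "m \<in> carrier M" "n \<in> carrier M" "K = cls m" "L = cls n"
      using KL by (auto simp: carrier_Q)
    let ?U = "{k \<in> carrier M. cls k \<in> U}"
    have "openin (action_topology M \<tau>) ?U" "m \<otimes> n \<in> ?U"
      using U KL mn by (auto simp: openin_powder_iff mult_cls)
    then obtain V W where VW: "openin (action_topology M \<tau>) V" "openin (action_topology M \<tau>) W"
      "m \<in> V" "n \<in> W" "\<forall>m'\<in>V. \<forall>n'\<in>W. m' \<otimes> n' \<in> ?U"
      by (rule continuous_mult_action_topology [OF _ mn(1,2)])
    have "V \<subseteq> carrier M" "W \<subseteq> carrier M"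
      using VW(1,2) [THEN openin_subset] by (simp_all add: topspace_action_topology)
    then have "cls ` V \<times> cls ` W \<subseteq>
        {z \<in> carrier Q \<times> carrier Q. (case z of (m, n) \<Rightarrow> m \<otimes>\<^bsub>Q\<^esub> n) \<in> U}"
      using VW(5) by (auto simp: carrier_Q mult_cls subset_iff)
    then show ?thesis
      using VW(1-4) mn openin_cls_image by (intro exI [of _ "cls ` V"] exI [of _ "cls ` W"]) auto
  qed
  then have "continuous_map (prod_topology ?P ?P) ?P (\<lambda>(m, n). m \<otimes>\<^bsub>Q\<^esub> n)"
    using Group.monoid.m_closed [OF monoid_Q]
    by (auto simp: continuous_map_def openin_prod_topology_alt topspace_powder)
  then show ?thesis
    by (simp add: topological_monoid_def monoid_Q topspace_powder)
qed

lemma t0_space_powder: "t0_space (powder_topology M \<tau>)"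
  unfolding t0_space_def topspace_powder
proof (intro ballI impI)
  fix K L assume "K \<in> carrier Q" "L \<in> carrier Q" "K \<noteq> L"
  then obtain m n where mn: "m \<in> carrier M" "n \<in> carrier M" "K = cls m" "L = cls n" "cls m \<noteq> cls n"
    by (auto simp: carrier_Q)
  then obtain U where U: "openin (action_topology M \<tau>) U" "m \<in> U \<longleftrightarrow> n \<notin> U"
    by (auto simp: cls_eq_iff)
  have "cls k \<in> cls ` U \<longleftrightarrow> k \<in> U" if "k \<in> carrier M" for k
    using saturated_openin_action_topology [OF U(1)] that by blast
  then show "\<exists>U. openin (powder_topology M \<tau>) U \<and> (K \<notin> U) = (L \<in> U)"
    using mn U openin_cls_image by (intro exI [of _ "cls ` U"]) auto
qed

section \<open>The action topology of the quotient\<close>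

lemma vimage_translate_Q:
  assumes "p \<in> carrier M"
  shows "{m \<in> carrier M. cls m \<in> translate Q (cls p) B} = translate M p {m \<in> carrier M. cls m \<in> B}"
  using assms by (auto simp: translate_def carrier_Q mult_cls)

lemma vimage_cls_inject:
  assumes "A \<subseteq> carrier Q" and "B \<subseteq> carrier Q"
  shows "{m \<in> carrier M. cls m \<in> A} = {m \<in> carrier M. cls m \<in> B} \<longleftrightarrow> A = B"
proof -
  have "V = cls ` {m \<in> carrier M. cls m \<in> V}" if "V \<subseteq> carrier Q" for V
    using that by (auto simp: carrier_Q)
  then show ?thesis
    using assms by metis
qed

text \<open>\<open>cls\<close> is onto \<open>carrier Q\<close>, so equality of translates in
  \<open>Q\<close> may be tested on preimages in \<open>M\<close>. Base conditions on
  \<open>Q\<close> thereby become conditions on \<open>M\<close>.\<close>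

lemma vimage_same_translate_Q:
  assumes p: "p \<in> carrier M"
  shows "{m \<in> carrier M. cls m \<in> same_translate Q (cls p) B} =
    same_translate M p {m \<in> carrier M. cls m \<in> B}"
proof -
  have "translate Q (cls m) B = translate Q (cls p) B \<longleftrightarrow>
      translate M m {m \<in> carrier M. cls m \<in> B} = translate M p {m \<in> carrier M. cls m \<in> B}"
    if "m \<in> carrier M" for m
    using vimage_cls_inject [of "translate Q (cls m) B" "translate Q (cls p) B"]
    unfolding vimage_translate_Q [OF that] vimage_translate_Q [OF p]
    by (simp add: translate_def)
  then show ?thesis
    by (auto simp: same_translate_def carrier_Q)
qed

lemma action_base_Q:
  assumes A: "A \<in> action_base M \<tau>"
  shows "cls ` A \<in> action_base Q (powder_topology M \<tau>)"
proof -
  have sub: "A \<subseteq> carrier M"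
    using A by (simp add: action_base_def)
  have sat: "{m \<in> carrier M. cls m \<in> cls ` A} = A"
    using A by (intro saturated_openin_action_topology action_base_openin_action_topology)
  have "openin (powder_topology M \<tau>) (same_translate Q (cls p) (translate Q (cls q) (cls ` A)))"
    if "p \<in> carrier M" "q \<in> carrier M" for p q
  proof -
    have "{m \<in> carrier M. cls m \<in> same_translate Q (cls p) (translate Q (cls q) (cls ` A))} =
        same_translate M p (translate M q A)"
      using that by (simp add: vimage_same_translate_Q vimage_translate_Q sat)
    \<comment> \<open>Membership in the base gives only openness in \<tau>, while the quotient
      topology needs openness in the action topology. Closure of the base under both operations
      supplies it.\<close>
    moreover have "openin (action_topology M \<tau>) (same_translate M p (translate M q A))"
      using A that by (intro action_base_openin_action_topology same_translate_in_action_base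
          translate_in_action_base)
    ultimately show ?thesis
      by (auto simp: openin_powder_iff same_translate_def)
  qed
  then show ?thesis
    using sub by (auto simp: action_base_def carrier_Q)
qed

lemma action_topology_powder:
  "action_topology Q (powder_topology M \<tau>) = powder_topology M \<tau>"
proof -
  \<comment> \<open>The general theory applied to \<open>Q\<close> gives one inclusion of
    topologies: action-open sets are open. The other uses images of base sets of
    \<open>M\<close>.\<close>
  interpret Q: monoid_with_topology Q "powder_topology M \<tau>"
    using monoid_Q topspace_powder
    by (simp add: monoid_with_topology_def monoid_with_topology_axioms_def)
  have "openin (action_topology Q (powder_topology M \<tau>)) V" if V: "openin (powder_topology M \<tau>) V" for V
    unfolding Q.openin_action_topology_iff
  proof
    fix K assume "K \<in> V"
    with V obtain m where m: "m \<in> carrier M" "K = cls m"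
      by (auto simp: openin_powder_iff carrier_Q)
    with V \<open>K \<in> V\<close> obtain A where A: "A \<in> action_base M \<tau>" "m \<in> A" "A \<subseteq> {m \<in> carrier M. cls m \<in> V}"
      by (auto simp: openin_powder_iff openin_action_topology_iff)
    then have "K \<in> cls ` A" "cls ` A \<subseteq> V"
      using m by auto
    then show "\<exists>A\<in>action_base Q (powder_topology M \<tau>). K \<in> A \<and> A \<subseteq> V"
      using action_base_Q [OF A(1)] by blast
  qed
  then show ?thesis
    using Q.openin_action_topology_imp_openin by (auto simp: topology_eq)
qed

lemma powder_monoid_Q: "powder_monoid Q (powder_topology M \<tau>)"
  by (simp add: powder_monoid_def topological_monoid_Q t0_space_powder action_topology_powder)

section \<open>The isomorphism of categories\<close>

text \<open>The chosen representative does not matter for continuous \<open>X\<close>, by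
  \<open>act_cong_cls\<close>. Restricting the action keeps it extensional, so that
  \<open>pullback\<close> becomes a strict inverse.\<close>

definition descend :: "('x, 'm) right_set \<Rightarrow> ('x, 'm set) right_set" where
  "descend X = \<lparr>Car = Car X, act = (\<lambda>(x, K)\<in>Car X \<times> carrier Q. act X (x, SOME m. m \<in> K))\<rparr>"

definition pullback :: "('x, 'm set) right_set \<Rightarrow> ('x, 'm) right_set" where
  "pullback Y = \<lparr>Car = Car Y, act = (\<lambda>(x, m)\<in>Car Y \<times> carrier M. act Y (x, cls m))\<rparr>"

lemma Car_descend [simp]: "Car (descend X) = Car X"
  by (simp add: descend_def)

lemma Car_pullback [simp]: "Car (pullback Y) = Car Y"
  by (simp add: pullback_def)

lemma act_pullback [simp]:
  "x \<in> Car Y \<Longrightarrow> m \<in> carrier M \<Longrightarrow> act (pullback Y) (x, m) = act Y (x, cls m)"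
  by (simp add: pullback_def)

text \<open>The fibre of the action through \<open>m\<close> is open in the action topology, so it
  contains \<open>n\<close> too.\<close>

lemma act_cong_cls:
  assumes X: "is_cont_set M \<tau> X" and x: "x \<in> Car X"
    and "m \<in> carrier M" "n \<in> carrier M" "cls m = cls n"
  shows "act X (x, m) = act X (x, n)"
  using action_base_openin_action_topology [OF action_fibre_in_action_base [OF X x, of "act X (x, m)"]]
    assms(3-5) by (auto simp: cls_eq_iff)

lemma act_descend:
  assumes X: "is_cont_set M \<tau> X" and x: "x \<in> Car X" and m: "m \<in> carrier M"
  shows "act (descend X) (x, cls m) = act X (x, m)"
proof -
  have "m \<in> cls m"
    using m by (simp add: mem_cls_iff)
  then have "(SOME n. n \<in> cls m) \<in> cls m"
    by (rule someI)
  then show ?thesis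
    using X x m act_cong_cls [OF X x m, of "SOME n. n \<in> cls m"]
    by (auto simp: mem_cls_iff descend_def carrier_Q)
qed

lemma is_cont_set_descend:
  assumes X: "is_cont_set M \<tau> X"
  shows "is_cont_set Q (powder_topology M \<tau>) (descend X)"
proof -
  have XR: "is_right_set M X"
    using X by (simp add: is_cont_set_def)
  have closed: "act X (x, m) \<in> Car X" if "x \<in> Car X" "m \<in> carrier M" for x m
    using XR that by (auto simp: is_right_set_def)
  have ext: "act (descend X) \<in> extensional (Car X \<times> carrier Q)"
    by (simp add: descend_def)
  have "is_right_set Q (descend X)"
    using XR X ext closed
    by (auto simp: is_right_set_def carrier_Q one_Q mult_cls act_descend PiE_def)
  moreover have "openin (powder_topology M \<tau>) {K \<in> carrier Q. act (descend X) (x, K) = y}"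
    if "x \<in> Car X" "y \<in> Car X" for x y
  proof -
    \<comment> \<open>The preimage of a fibre of \<open>descend X\<close> is a fibre of
      \<open>X\<close>, which is a base set and hence open in the action topology, as the quotient
      topology demands.\<close>
    have "{m \<in> carrier M. cls m \<in> {K \<in> carrier Q. act (descend X) (x, K) = y}} =
        {m \<in> carrier M. act X (x, m) = y}"
      using that X by (auto simp: carrier_Q act_descend)
    then show ?thesis
      using action_base_openin_action_topology [OF action_fibre_in_action_base [OF X that(1)]]
      by (auto simp: openin_powder_iff)
  qed
  ultimately show ?thesis
    by (simp add: is_cont_set_iff topspace_powder)
qed

lemma is_cont_set_pullback:
  assumes Y: "is_cont_set Q (powder_topology M \<tau>) Y"
  shows "is_cont_set M \<tau> (pullback Y)"
proof -
  have YR: "is_right_set Q Y"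
    and op: "\<And>x y. \<lbrakk>x \<in> Car Y; y \<in> Car Y\<rbrakk> \<Longrightarrow>
      openin (powder_topology M \<tau>) {K \<in> carrier Q. act Y (x, K) = y}"
    using Y by (auto simp: is_cont_set_iff topspace_powder)
  have closed: "act Y (x, cls m) \<in> Car Y" if "x \<in> Car Y" "m \<in> carrier M" for x m
    using YR that by (auto simp: is_right_set_def carrier_Q)
  have ext: "act (pullback Y) \<in> extensional (Car Y \<times> carrier M)"
    by (simp add: pullback_def)
  have "act Y (x, cls (m \<otimes> n)) = act Y (act Y (x, cls m), cls n)"
    if "x \<in> Car Y" "m \<in> carrier M" "n \<in> carrier M" for x m n
    using that YR by (simp add: is_right_set_def carrier_Q flip: mult_cls)
  then have "is_right_set M (pullback Y)"
    using YR ext closed by (auto simp: is_right_set_def PiE_def simp flip: one_Q)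
  moreover have "openin \<tau> {m \<in> carrier M. act (pullback Y) (x, m) = y}"
    if "x \<in> Car Y" "y \<in> Car Y" for x y
  proof -
    have "{m \<in> carrier M. act (pullback Y) (x, m) = y} =
        {m \<in> carrier M. cls m \<in> {K \<in> carrier Q. act Y (x, K) = y}}"
      using that by (auto simp: carrier_Q)
    then show ?thesis
      using op [OF that] openin_action_topology_imp_openin by (simp add: openin_powder_iff)
  qed
  ultimately show ?thesis
    by (simp add: is_cont_set_iff topspace_eq)
qed

lemma pullback_descend:
  assumes X: "is_cont_set M \<tau> X"
  shows "pullback (descend X) = X"
proof (rule right_set.equality)
  have "act X \<in> extensional (Car X \<times> carrier M)"
    using X by (auto simp: is_cont_set_def is_right_set_def PiE_def)
  then show "act (pullback (descend X)) = act X"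
    using X by (intro extensionalityI [of _ "Car X \<times> carrier M"])
      (auto simp: act_descend, simp add: pullback_def)
qed auto

lemma descend_pullback:
  assumes Y: "is_cont_set Q (powder_topology M \<tau>) Y"
  shows "descend (pullback Y) = Y"
proof (rule right_set.equality)
  have "act Y \<in> extensional (Car Y \<times> carrier Q)"
    using Y by (auto simp: is_cont_set_def is_right_set_def PiE_def)
  then show "act (descend (pullback Y)) = act Y"
    using is_cont_set_pullback [OF Y] by (intro extensionalityI [of _ "Car Y \<times> carrier Q"])
      (auto simp: act_descend carrier_Q, simp add: descend_def carrier_Q)
qed auto

text \<open>Carriers are unchanged and every element of \<open>Q\<close> is some
  \<open>cls m\<close>, acting as \<open>m\<close> does. Both categories therefore have the same
  underlying maps as arrows.\<close>

lemma equivariant_descend: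
  assumes "is_cont_set M \<tau> X" and "is_cont_set M \<tau> Y"
  shows "equivariant Q (descend X) (descend Y) f \<longleftrightarrow> equivariant M X Y f"
  using assms by (auto simp: equivariant_def carrier_Q act_descend PiE_def Pi_iff)

section \<open>The mutually inverse functors and the canonical points\<close>

definition descend_functor ::
  "(('x, 'm) right_set, ('x, 'm) right_set \<times> ('x \<Rightarrow> 'x) \<times> ('x, 'm) right_set,
    ('x, 'm set) right_set, ('x, 'm set) right_set \<times> ('x \<Rightarrow> 'x) \<times> ('x, 'm set) right_set) cat_functor"
  where "descend_functor = \<lparr>fobj = descend, farr = (\<lambda>(X, f, Y). (descend X, f, descend Y))\<rparr>"

definition pullback_functor ::
  "(('x, 'm set) right_set, ('x, 'm set) right_set \<times> ('x \<Rightarrow> 'x) \<times> ('x, 'm set) right_set,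
    ('x, 'm) right_set, ('x, 'm) right_set \<times> ('x \<Rightarrow> 'x) \<times> ('x, 'm) right_set) cat_functor"
  where "pullback_functor = \<lparr>fobj = pullback, farr = (\<lambda>(X, f, Y). (pullback X, f, pullback Y))\<rparr>"

lemma is_functor_descend:
  "is_functor (Cont M \<tau>) (Cont Q (powder_topology M \<tau>)) descend_functor"
  unfolding is_functor_def
  by (intro conjI category_Cont) (auto simp: Cont_def descend_functor_def is_cont_set_descend equivariant_descend)

lemma is_functor_pullback:
  "is_functor (Cont Q (powder_topology M \<tau>)) (Cont M \<tau>) pullback_functor"
proof -
  have "equivariant M (pullback X) (pullback Y) f"
    if "is_cont_set Q (powder_topology M \<tau>) X" "is_cont_set Q (powder_topology M \<tau>) Y"
      "equivariant Q X Y f" for X Y :: "('x, 'm set) right_set" and f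
    \<comment> \<open>The equivalence is used for the pullbacks, whose descents are \<open>X\<close>
      and \<open>Y\<close> again.\<close>
    using that equivariant_descend [OF is_cont_set_pullback is_cont_set_pullback, of X Y f]
    by (simp add: descend_pullback)
  then show ?thesis
    unfolding is_functor_def
    by (intro conjI category_Cont) (auto simp: Cont_def pullback_functor_def is_cont_set_pullback)
qed

lemma is_equivalence_descend:
  "is_equivalence (Cont M \<tau>) (Cont Q (powder_topology M \<tau>)) descend_functor"
  by (rule is_equivalenceI_inverse [OF is_functor_descend is_functor_pullback])
    (auto simp: Cont_def descend_functor_def pullback_functor_def pullback_descend descend_pullback)

text \<open>\<open>descend_functor\<close> alters neither carriers nor underlying maps, so the two
  functors agree exactly on objects and arrows.\<close>

lemma point_inverse_image_descend:
  "naturally_isomorphic (Cont M \<tau>) Set_cat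
    (comp_functor point_inverse_image descend_functor) point_inverse_image"
  by (rule naturally_isomorphic_eqI
      [OF is_functor_comp [OF is_functor_descend is_functor_point_inverse_image]
        is_functor_point_inverse_image])
    (auto simp: comp_functor_def descend_functor_def point_inverse_image_def)

end

theorem theorem2p18:
  fixes M :: "('m, 'b) monoid_scheme" and \<tau> :: "'m topology"
  assumes "Group.monoid M" and "topspace \<tau> = carrier M"
  shows "powder_monoid (powder_quotient M \<tau>) (powder_topology M \<tau>) \<and>
    (\<exists>E. is_equivalence
           (Cont M \<tau> :: (('x, 'm) right_set, _) category)
           (Cont (powder_quotient M \<tau>) (powder_topology M \<tau>) :: (('x, 'm set) right_set, _) category)
           E \<and>
         naturally_isomorphic (Cont M \<tau>) Set_cat
           (comp_functor point_inverse_image E) point_inverse_image)"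
proof -
  interpret monoid_with_topology M \<tau>
    using assms by (simp add: monoid_with_topology_def monoid_with_topology_axioms_def)
  show ?thesis
    using powder_monoid_Q is_equivalence_descend point_inverse_image_descend by blast
qed

end
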